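(* Let $a\ge 1$, $n\ge 1$, $b\ge 3$ be integers, let $G_{a,b,n}=\overline{K}_a\nabla(nB_b)$, and let $A$ be the set of the $a$ vertices of $\overline{K}_a$. Let $\Gamma_b:=\Delta(B_b)$ be the independence complex of $B_b$. Then $\Gamma_b\cong C_{b,b}$ (the crown graph) as a $1$-dimensional simplicial complex, and $$\Delta(G_{a,b,n})=\langle A\rangle\cup\Gamma_b^{\star n},$$ where $\langle A\rangle$ is the simplex on the vertex set $A$ (all subsets of $A$) and $\Gamma_b^{\star n}$ is the $n$-fold simplicial join of $\Gamma_b$ with itself (one copy for each copy of $B_b$). The two pieces $\langle A\rangle$ and $\Gamma_b^{\star n}$ have disjoint vertex sets. Furthermore: (i) $\dim\Gamma_b=1$ and $\dim\Gamma_b^{\star n}=2n-1$; (ii) the facets of $\Gamma_b^{\star n}$ are precisely the unions of one edge of $\Gamma_b$ from each block; (iii) the number of facets of $\Gamma_b^{\star n}$ is $\big(b(b-1)\big)^n$; (iv) $\Delta(G_{a,b,n})$ is pure if and only if $a=2n$.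
   Context: All graphs are finite, simple and undirected. For $b\ge 2$, $B_b$ (also written $K_b+K_2$) is the graph with vertices $x_1,\dots,x_b,y_1,\dots,y_b$ and edges $\{x_i,x_j\}$ and $\{y_i,y_j\}$ for $1\le i<j\le b$, and $\{x_i,y_i\}$ for $1\le i\le b$. $nB_b$ is the disjoint union of $n$ copies ("blocks") of $B_b$. The join $G\nabla H$ of graphs on disjoint vertex sets is obtained from the disjoint union by adding every edge between $V(G)$ and $V(H)$. $\overline{K}_a$ is the edgeless graph on $a$ vertices. The independence complex of a graph $G$ is $\Delta(G)=\{F\subseteq V(G): F\text{ is independent in }G\}$. The simplicial join of complexes on disjoint vertex sets is $\Delta_1\star\Delta_2=\{F_1\cup F_2: F_1\in\Delta_1,F_2\in\Delta_2\}$. The crown graph $C_{b,b}$ is the bipartite graph with parts $\{x_1,\dots,x_b\}$ and $\{y_1,\dots,y_b\}$ in which $x_i$ and $y_j$ are adjacent iff $i\ne j$. A complex is pure if all its facets have the same cardinality. *)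

theory Defs
  imports Main
begin

section \<open>Finite simple graphs\<close>

record 'v graph =
  verts :: "'v set"
  edges :: "'v set set"

definition simple_graph :: "'v graph \<Rightarrow> bool" where
  "simple_graph G \<longleftrightarrow>
     finite (verts G) \<and> (\<forall>e\<in>edges G. e \<subseteq> verts G \<and> card e = 2)"

text \<open>The join is only meant for graphs with disjoint vertex sets.\<close>

definition graph_join :: "'v graph \<Rightarrow> 'v graph \<Rightarrow> 'v graph" (infixr "\<nabla>" 65) where
  "G \<nabla> H = \<lparr> verts = verts G \<union> verts H,
     edges = edges G \<union> edges H \<union> {{u, v} | u v. u \<in> verts G \<and> v \<in> verts H} \<rparr>"

datatype xy = X nat | Y nat

definition B :: "nat \<Rightarrow> xy graph" where
  "B b = \<lparr> verts = X ` {1..b} \<union> Y ` {1..b},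
     edges = {{X i, X j} | i j. 1 \<le> i \<and> i < j \<and> j \<le> b}
           \<union> {{Y i, Y j} | i j. 1 \<le> i \<and> i < j \<and> j \<le> b}
           \<union> {{X i, Y i} | i. 1 \<le> i \<and> i \<le> b} \<rparr>"

definition crown :: "nat \<Rightarrow> xy graph" where
  "crown b = \<lparr> verts = X ` {1..b} \<union> Y ` {1..b},
     edges = {{X i, Y j} | i j. i \<in> {1..b} \<and> j \<in> {1..b} \<and> i \<noteq> j} \<rparr>"

text \<open>
  Labels that make the vertex sets of the edgeless graph and of the blocks disjoint:
  \<open>Block k v\<close> is the vertex \<open>v\<close> of the \<open>k\<close>-th block.
\<close>

datatype 'v label = Apex nat | Block nat 'v

definition edgeless :: "nat \<Rightarrow> 'v label graph" where
  "edgeless a = \<lparr> verts = Apex ` {1..a}, edges = {} \<rparr>"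

definition copies :: "nat \<Rightarrow> 'v graph \<Rightarrow> 'v label graph" where
  "copies n G = \<lparr> verts = (\<Union>k\<in>{1..n}. Block k ` verts G),
     edges = (\<Union>k\<in>{1..n}. (\<lambda>e. Block k ` e) ` edges G) \<rparr>"

definition Gabn :: "nat \<Rightarrow> nat \<Rightarrow> nat \<Rightarrow> xy label graph" where
  "Gabn a b n = edgeless a \<nabla> copies n (B b)"


section \<open>Abstract simplicial complexes, given by their sets of faces\<close>

definition vertex_set :: "'v set set \<Rightarrow> 'v set" where
  "vertex_set \<Delta> = {v. {v} \<in> \<Delta>}"

definition simplex_on :: "'v set \<Rightarrow> 'v set set" where
  "simplex_on A = Pow A"

definition indep_complex :: "'v graph \<Rightarrow> 'v set set" where
  "indep_complex G = {F. F \<subseteq> verts G \<and> (\<forall>u\<in>F. \<forall>v\<in>F. {u, v} \<notin> edges G)}"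

definition graph_complex :: "'v graph \<Rightarrow> 'v set set" where
  "graph_complex G = {{}} \<union> (\<lambda>v. {v}) ` verts G \<union> edges G"

definition complex_iso :: "'v set set \<Rightarrow> 'w set set \<Rightarrow> bool" (infix "\<cong>\<^sub>c" 50) where
  "\<Delta> \<cong>\<^sub>c \<Delta>' \<longleftrightarrow>
     (\<exists>f. bij_betw f (vertex_set \<Delta>) (vertex_set \<Delta>') \<and> (\<lambda>F. f ` F) ` \<Delta> = \<Delta>')"

definition facets :: "'v set set \<Rightarrow> 'v set set" where
  "facets \<Delta> = {F \<in> \<Delta>. \<forall>F'\<in>\<Delta>. F \<subseteq> F' \<longrightarrow> F' = F}"

definition pure :: "'v set set \<Rightarrow> bool" where
  "pure \<Delta> \<longleftrightarrow> (\<forall>F\<in>facets \<Delta>. \<forall>F'\<in>facets \<Delta>. card F = card F')"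

text \<open>Meaningful for nonempty finite complexes; the complex \<open>{{}}\<close> has dimension \<open>- 1\<close>.\<close>

definition complex_dim :: "'v set set \<Rightarrow> int" where
  "complex_dim \<Delta> = Max ((\<lambda>F. int (card F) - 1) ` \<Delta>)"

definition complex_edges :: "'v set set \<Rightarrow> 'v set set" where
  "complex_edges \<Delta> = {F \<in> \<Delta>. card F = 2}"

text \<open>The simplicial join is only meant for complexes with disjoint vertex sets.\<close>

definition simplicial_join :: "'v set set \<Rightarrow> 'v set set \<Rightarrow> 'v set set" (infixl "\<star>" 65) where
  "\<Delta>\<^sub>1 \<star> \<Delta>\<^sub>2 = {F\<^sub>1 \<union> F\<^sub>2 | F\<^sub>1 F\<^sub>2. F\<^sub>1 \<in> \<Delta>\<^sub>1 \<and> F\<^sub>2 \<in> \<Delta>\<^sub>2}"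

definition block_complex :: "nat \<Rightarrow> 'v set set \<Rightarrow> 'v label set set" where
  "block_complex k \<Delta> = (\<lambda>F. Block k ` F) ` \<Delta>"

text \<open>
  The \<open>n\<close>-fold join of a complex with itself, the factors being the copies
  of the complex in blocks \<open>1, \<dots>, n\<close>; \<open>{{}}\<close> is the unit of the join.
\<close>

primrec join_power :: "'v set set \<Rightarrow> nat \<Rightarrow> 'v label set set" where
  "join_power \<Delta> 0 = {{}}"
| "join_power \<Delta> (Suc n) = join_power \<Delta> n \<star> block_complex (Suc n) \<Delta>"


section \<open>The graphs above are finite simple graphs on disjoint vertex sets\<close>

lemma simple_graph_join:
  assumes "simple_graph G" "simple_graph H" "verts G \<inter> verts H = {}"
  shows "simple_graph (G \<nabla> H)"
proof -
  have "card {u, v} = 2" if "u \<in> verts G" "v \<in> verts H" for u v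
    using that assms(3) by (cases "u = v") auto
  then show ?thesis
    using assms(1,2) by (fastforce simp: simple_graph_def graph_join_def)
qed

lemma simple_graph_B: "simple_graph (B b)"
  by (auto simp: simple_graph_def B_def)

lemma simple_graph_crown: "simple_graph (crown b)"
  by (auto simp: simple_graph_def crown_def)

lemma simple_graph_edgeless: "simple_graph (edgeless a)"
  by (auto simp: simple_graph_def edgeless_def)

lemma simple_graph_copies:
  assumes "simple_graph G"
  shows "simple_graph (copies n G)"
proof -
  have "card (Block k ` e) = card e" for k :: nat and e :: "'a set"
    by (rule card_image) (simp add: inj_on_def)
  then show ?thesis
    using assms by (fastforce simp: simple_graph_def copies_def)
qed

lemma edgeless_copies_disjoint: "verts (edgeless a) \<inter> verts (copies n G) = {}"
  by (auto simp: edgeless_def copies_def)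

lemma simple_graph_Gabn: "simple_graph (Gabn a b n)"
  unfolding Gabn_def
  by (intro simple_graph_join simple_graph_edgeless simple_graph_copies simple_graph_B
      edgeless_copies_disjoint)

end

theory Submission
  imports Defs "HOL-Library.FuncSet"
begin

text \<open>
  A set independent in \<open>B b\<close> contains at most one \<open>X i\<close> and at most one \<open>Y j\<close>, and then
  \<open>i \<noteq> j\<close>; so the independence complex of \<open>B b\<close> is literally the crown graph, without
  relabelling.  A face of the \<open>n\<close>-fold join is the same thing as a family of \<open>n\<close> faces, one per
  block, and inclusion of faces is blockwise inclusion; hence its facets are the families of
  facets.  As an independent set of a graph join lies on one side, \<open>\<Delta>(G)\<close> is a union of two
  complexes without common vertex, whose facets are \<open>A\<close> (of size \<open>a\<close>) and those of
  the join power (all of size \<open>2 n\<close>).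
\<close>

section \<open>Faces of a join power as families of faces indexed by the blocks\<close>

definition block_union :: "nat \<Rightarrow> (nat \<Rightarrow> 'v set) \<Rightarrow> 'v label set" where
  "block_union n e = (\<Union>k\<in>{1..n}. Block k ` e k)"

text \<open>The constructor \<open>Block\<close> is injective in both arguments, so each
  \<open>e k\<close> with \<open>k\<close> in \<open>{1..n}\<close> can be recovered from the union.
  Values of \<open>e\<close> outside \<open>{1..n}\<close> leave no trace in it.\<close>

lemma block_union_subset_iff:
  "block_union n e \<subseteq> block_union n e' \<longleftrightarrow> (\<forall>k\<in>{1..n}. e k \<subseteq> e' k)"
  unfolding block_union_def by blast

lemma block_union_eq_iff:
  "block_union n e = block_union n e' \<longleftrightarrow> (\<forall>k\<in>{1..n}. e k = e' k)"
  by (simp only: set_eq_subset block_union_subset_iff) blast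

lemma block_union_Suc:
  "block_union (Suc n) e = block_union n e \<union> Block (Suc n) ` e (Suc n)"
  by (auto simp: block_union_def atLeastAtMostSuc_conv)

lemma card_block_union:
  assumes "\<And>k. k \<in> {1..n} \<Longrightarrow> finite (e k)"
  shows "card (block_union n e) = (\<Sum>k=1..n. card (e k))"
proof -
  have "card (block_union n e) = (\<Sum>k=1..n. card (Block k ` e k))"
    unfolding block_union_def using assms by (subst card_UN_disjoint) auto
  also have "\<dots> = (\<Sum>k=1..n. card (e k))"
    by (intro sum.cong refl card_image) (simp add: inj_on_def)
  finally show ?thesis .
qed

lemma join_power_eq:
  "join_power \<Delta> n = {block_union n e | e. \<forall>k\<in>{1..n}. e k \<in> \<Delta>}"
proof (induction n)
  case 0
  show ?case by (simp add: block_union_def)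
next
  case (Suc n)
  show ?case
  proof (intro equalityI subsetI)
    fix F assume "F \<in> join_power \<Delta> (Suc n)"
    then obtain e F' where F: "F = block_union n e \<union> Block (Suc n) ` F'"
      and e: "\<forall>k\<in>{1..n}. e k \<in> \<Delta>" and F': "F' \<in> \<Delta>"
      unfolding join_power.simps simplicial_join_def Suc.IH block_complex_def by blast
    \<comment> \<open>The update changes \<open>e\<close> only outside \<open>{1..n}\<close>, so it
      extends the family by one face without disturbing the earlier blocks.\<close>
    have "block_union n (e(Suc n := F')) = block_union n e"
      by (simp add: block_union_eq_iff)
    then have "F = block_union (Suc n) (e(Suc n := F'))"
      by (simp add: F block_union_Suc)
    moreover have "\<forall>k\<in>{1..Suc n}. (e(Suc n := F')) k \<in> \<Delta>"
      using e F' by auto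
    ultimately show "F \<in> {block_union (Suc n) e | e. \<forall>k\<in>{1..Suc n}. e k \<in> \<Delta>}"
      by blast
  next
    fix F assume "F \<in> {block_union (Suc n) e | e. \<forall>k\<in>{1..Suc n}. e k \<in> \<Delta>}"
    then obtain e where e: "F = block_union (Suc n) e" "\<forall>k\<in>{1..Suc n}. e k \<in> \<Delta>"
      by blast
    have "block_union n e \<in> join_power \<Delta> n"
      unfolding Suc.IH using e(2) by auto
    moreover have "Block (Suc n) ` e (Suc n) \<in> block_complex (Suc n) \<Delta>"
      using e(2) by (simp add: block_complex_def)
    ultimately show "F \<in> join_power \<Delta> (Suc n)"
      by (auto simp: simplicial_join_def e(1) block_union_Suc)
  qed
qed

lemma finite_join_power:
  assumes "finite \<Delta>"
  shows "finite (join_power \<Delta> n)"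
proof (induction n)
  case (Suc n)
  have "join_power \<Delta> (Suc n) = (\<lambda>(F, F'). F \<union> F') ` (join_power \<Delta> n \<times> block_complex (Suc n) \<Delta>)"
    by (auto simp: simplicial_join_def)
  then show ?case
    using Suc assms by (simp add: block_complex_def)
qed simp

lemma facets_join_power:
  "facets (join_power \<Delta> n) = {block_union n e | e. \<forall>k\<in>{1..n}. e k \<in> facets \<Delta>}"
proof (intro set_eqI iffI)
  fix F assume F: "F \<in> facets (join_power \<Delta> n)"
  then obtain e where e: "F = block_union n e" "\<forall>k\<in>{1..n}. e k \<in> \<Delta>"
    by (auto simp: facets_def join_power_eq)
  \<comment> \<open>Maximality can be tested one block at a time: replacing the single entry
    \<open>e k\<close> by a larger face \<open>F'\<close> would give a larger face of the join
    power.\<close>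
  have "F' = e k" if k: "k \<in> {1..n}" and F': "F' \<in> \<Delta>" "e k \<subseteq> F'" for k F'
  proof -
    have "block_union n (e(k := F')) \<in> join_power \<Delta> n"
      using e(2) F'(1) by (auto simp: join_power_eq)
    moreover have "F \<subseteq> block_union n (e(k := F'))"
      using F'(2) by (simp add: e(1) block_union_subset_iff)
    ultimately have "block_union n (e(k := F')) = block_union n e"
      using F e(1) by (auto simp: facets_def)
    then show ?thesis
      using k by (metis block_union_eq_iff fun_upd_same)
  qed
  then have "\<forall>k\<in>{1..n}. e k \<in> facets \<Delta>"
    using e(2) by (auto simp: facets_def)
  then show "F \<in> {block_union n e | e. \<forall>k\<in>{1..n}. e k \<in> facets \<Delta>}"
    using e(1) by blast
next
  fix F assume "F \<in> {block_union n e | e. \<forall>k\<in>{1..n}. e k \<in> facets \<Delta>}"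
  then obtain e where e: "F = block_union n e" "\<forall>k\<in>{1..n}. e k \<in> facets \<Delta>"
    by blast
  have "F' = F" if "F' \<in> join_power \<Delta> n" "F \<subseteq> F'" for F'
  proof -
    obtain e' where e': "F' = block_union n e'" "\<forall>k\<in>{1..n}. e' k \<in> \<Delta>"
      using \<open>F' \<in> join_power \<Delta> n\<close> by (auto simp: join_power_eq)
    have "e' k = e k" if "k \<in> {1..n}" for k
      using e e' \<open>F \<subseteq> F'\<close> that by (simp add: block_union_subset_iff facets_def)
    then show ?thesis
      by (simp add: e(1) e'(1) block_union_eq_iff)
  qed
  moreover have "F \<in> join_power \<Delta> n"
    using e by (auto simp: facets_def join_power_eq)
  ultimately show "F \<in> facets (join_power \<Delta> n)"
    by (simp add: facets_def)
qed

lemma card_facets_join_power: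
  "card (facets (join_power \<Delta> n)) = card (facets \<Delta>) ^ n"
proof -
  \<comment> \<open>Families that differ only outside \<open>{1..n}\<close> have the same union. The
    extensional functions in \<open>PiE\<close> choose one representative each, which makes
    \<open>block_union n\<close> injective and reduces the count to \<open>card_PiE\<close>.\<close>
  have "facets (join_power \<Delta> n) = block_union n ` (\<Pi>\<^sub>E k\<in>{1..n}. facets \<Delta>)"
  proof (intro equalityI subsetI)
    fix F assume "F \<in> facets (join_power \<Delta> n)"
    then obtain e where e: "F = block_union n e" "\<forall>k\<in>{1..n}. e k \<in> facets \<Delta>"
      by (auto simp: facets_join_power)
    then have "F = block_union n (restrict e {1..n})"
      by (simp add: block_union_eq_iff)
    moreover have "restrict e {1..n} \<in> (\<Pi>\<^sub>E k\<in>{1..n}. facets \<Delta>)"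
      using e(2) by auto
    ultimately show "F \<in> block_union n ` (\<Pi>\<^sub>E k\<in>{1..n}. facets \<Delta>)"
      by blast
  qed (auto simp: facets_join_power PiE_iff)
  moreover have "inj_on (block_union n) (\<Pi>\<^sub>E k\<in>{1..n}. facets \<Delta>)"
  proof (rule inj_onI)
    fix e e' assume "e \<in> (\<Pi>\<^sub>E k\<in>{1..n}. facets \<Delta>)" "e' \<in> (\<Pi>\<^sub>E k\<in>{1..n}. facets \<Delta>)"
      and "block_union n e = block_union n e'"
    then show "e = e'"
      by (intro PiE_ext) (auto simp: block_union_eq_iff)
  qed
  ultimately show ?thesis
    by (simp add: card_image card_PiE)
qed

section \<open>Facets of a union of two complexes, and a criterion for the dimension\<close>

lemma facets_Un_disjoint:
  assumes "\<Union>\<Delta> \<inter> \<Union>\<Delta>' = {}" "\<Union>\<Delta> \<noteq> {}" "\<Union>\<Delta>' \<noteq> {}"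
  shows "facets (\<Delta> \<union> \<Delta>') = facets \<Delta> \<union> facets \<Delta>'"
proof -
  \<comment> \<open>A nonempty facet has a vertex in only one of the two complexes, so every face
    above it lies in that same complex. An empty facet of one complex would instead lie below faces
    of the other.\<close>
  have nonempty: "F \<noteq> {}" if "F \<in> facets D" "\<Union>D \<noteq> {}" for F :: "'a set" and D
    using that by (auto simp: facets_def)
  have "F \<in> facets (\<Delta> \<union> \<Delta>')" if F: "F \<in> facets \<Delta> \<union> facets \<Delta>'" for F
  proof -
    have "F \<noteq> {}" using F nonempty assms by blast
    then show ?thesis
      using F assms(1) unfolding facets_def by blast
  qed
  then show ?thesis
    by (auto simp: facets_def)
qed

lemma complex_dim_eqI:
  assumes "finite \<Delta>" "\<And>F. F \<in> \<Delta> \<Longrightarrow> card F \<le> m" "F \<in> \<Delta>" "card F = m"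
  shows "complex_dim \<Delta> = int m - 1"
  unfolding complex_dim_def
proof (rule Max_eqI)
  show "int m - 1 \<in> (\<lambda>F. int (card F) - 1) ` \<Delta>"
    using assms(3,4) by blast
next
  show "k \<le> int m - 1" if k: "k \<in> (\<lambda>F. int (card F) - 1) ` \<Delta>" for k
  proof -
    obtain F where "F \<in> \<Delta>" "k = int (card F) - 1" using k by blast
    then show ?thesis using assms(2)[of F] by simp
  qed
qed (simp add: assms(1))

section \<open>Independence complexes of disjoint copies, graph joins and edgeless graphs\<close>

lemma indep_complex_copies:
  "indep_complex (copies n G) = join_power (indep_complex G) n"
proof -
  \<comment> \<open>No edge connects two blocks, and within a block injectivity of
    \<open>Block k\<close> pulls an edge back to \<open>G\<close>. Hence independence can be tested
    block by block.\<close>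
  have edge_iff: "{Block i u, Block j v} \<in> edges (copies n G)
      \<longleftrightarrow> i = j \<and> i \<in> {1..n} \<and> {u, v} \<in> edges G" for i j u v
  proof
    assume "{Block i u, Block j v} \<in> edges (copies n G)"
    then obtain k e where k: "k \<in> {1..n}" "e \<in> edges G" "{Block i u, Block j v} = Block k ` e"
      by (auto simp: copies_def)
    then have "i = k" "j = k" by blast+
    then have "Block k ` {u, v} = Block k ` e" using k(3) by simp
    then have "{u, v} = e" by (subst (asm) inj_image_eq_iff) (auto simp: inj_on_def)
    then show "i = j \<and> i \<in> {1..n} \<and> {u, v} \<in> edges G"
      using k \<open>i = k\<close> \<open>j = k\<close> by simp
  next
    assume "i = j \<and> i \<in> {1..n} \<and> {u, v} \<in> edges G"
    then show "{Block i u, Block j v} \<in> edges (copies n G)"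
      by (auto simp: copies_def intro!: bexI[of _ i] image_eqI[of _ _ "{u, v}"])
  qed
  show ?thesis
  proof (intro equalityI subsetI)
    fix F assume F: "F \<in> indep_complex (copies n G)"
    have "F = block_union n (\<lambda>k. Block k -` F)"
      using F by (fastforce simp: indep_complex_def copies_def block_union_def)
    moreover have "Block k -` F \<in> indep_complex G" if "k \<in> {1..n}" for k
    proof -
      have "Block k -` F \<subseteq> verts G"
        using F by (auto simp: indep_complex_def copies_def)
      moreover have "{u, v} \<notin> edges G" if "Block k u \<in> F" "Block k v \<in> F" for u v
        using F that edge_iff[of k u k v] \<open>k \<in> {1..n}\<close> by (simp add: indep_complex_def)
      ultimately show ?thesis by (auto simp: indep_complex_def)
    qed
    ultimately show "F \<in> join_power (indep_complex G) n"
      by (auto simp: join_power_eq)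
  next
    fix F assume "F \<in> join_power (indep_complex G) n"
    then obtain e where e: "F = block_union n e" "\<forall>k\<in>{1..n}. e k \<in> indep_complex G"
      by (auto simp: join_power_eq)
    then have "F \<subseteq> verts (copies n G)"
      by (fastforce simp: block_union_def indep_complex_def copies_def)
    moreover have "{u, v} \<notin> edges (copies n G)" if uv: "u \<in> F" "v \<in> F" for u v
    proof -
      obtain i u' j v' where "u = Block i u'" "v = Block j v'"
        "i \<in> {1..n}" "u' \<in> e i" "v' \<in> e j"
        using uv unfolding e(1) block_union_def by blast
      then show ?thesis
        using e(2) by (auto simp: edge_iff indep_complex_def)
    qed
    ultimately show "F \<in> indep_complex (copies n G)"
      by (simp add: indep_complex_def)
  qed
qed

lemma indep_complex_join:
  assumes "simple_graph G" "simple_graph H" "verts G \<inter> verts H = {}"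
  shows "indep_complex (G \<nabla> H) = indep_complex G \<union> indep_complex H"
proof (intro equalityI subsetI)
  fix F assume F: "F \<in> indep_complex (G \<nabla> H)"
  then have "\<not> (u \<in> F \<inter> verts G \<and> v \<in> F \<inter> verts H)" for u v
    unfolding indep_complex_def graph_join_def by auto
  then have "F \<inter> verts G = {} \<or> F \<inter> verts H = {}" by blast
  then show "F \<in> indep_complex G \<union> indep_complex H"
    using F by (auto simp: indep_complex_def graph_join_def)
next
  fix F assume F: "F \<in> indep_complex G \<union> indep_complex H"
  \<comment> \<open>An edge of either graph stays inside its own vertex set, so a set on one side
    cannot contain an edge of the other side.\<close>
  have "e \<subseteq> verts G" if "e \<in> edges G" for e
    using assms(1) that by (simp add: simple_graph_def)
  moreover have "e \<subseteq> verts H" if "e \<in> edges H" for e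
    using assms(2) that by (simp add: simple_graph_def)
  moreover have "verts G \<inter> F = {} \<or> verts H \<inter> F = {}"
    using F assms(3) by (auto simp: indep_complex_def)
  ultimately have "{u, v} \<notin> edges (G \<nabla> H)" if "u \<in> F" "v \<in> F" for u v
    using F assms(3) that unfolding indep_complex_def graph_join_def
    by (simp add: doubleton_eq_iff) blast
  then show "F \<in> indep_complex (G \<nabla> H)"
    using F by (auto simp: indep_complex_def graph_join_def)
qed

lemma indep_complex_edgeless: "indep_complex (edgeless a) = simplex_on (verts (edgeless a))"
  by (auto simp: indep_complex_def edgeless_def simplex_on_def)

section \<open>The block graph and the crown graph\<close>

text \<open>\<open>B\<close> lists its edges with \<open>i < j\<close>, whereas independence ranges
  over all ordered pairs. Trichotomy yields the symmetric form; for \<open>i = j\<close> the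
  doubleton collapses to a singleton, which is no edge.\<close>

lemma edge_B_iff:
  "{X i, X j} \<in> edges (B b) \<longleftrightarrow> i \<noteq> j \<and> i \<in> {1..b} \<and> j \<in> {1..b}"
  "{Y i, Y j} \<in> edges (B b) \<longleftrightarrow> i \<noteq> j \<and> i \<in> {1..b} \<and> j \<in> {1..b}"
  "{X i, Y j} \<in> edges (B b) \<longleftrightarrow> i = j \<and> i \<in> {1..b}"
  "{Y j, X i} \<in> edges (B b) \<longleftrightarrow> i = j \<and> i \<in> {1..b}"
proof -
  show "{X i, X j} \<in> edges (B b) \<longleftrightarrow> i \<noteq> j \<and> i \<in> {1..b} \<and> j \<in> {1..b}"
    by (cases i j rule: linorder_cases) (auto simp: B_def doubleton_eq_iff)
  show "{Y i, Y j} \<in> edges (B b) \<longleftrightarrow> i \<noteq> j \<and> i \<in> {1..b} \<and> j \<in> {1..b}"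
    by (cases i j rule: linorder_cases) (auto simp: B_def doubleton_eq_iff)
qed (auto simp: B_def doubleton_eq_iff)

lemma indep_complex_B: "indep_complex (B b) = graph_complex (crown b)"
proof (intro equalityI subsetI)
  fix F assume F: "F \<in> indep_complex (B b)"
  have sub: "F \<subseteq> X ` {1..b} \<union> Y ` {1..b}"
    using F by (auto simp: indep_complex_def B_def)
  have indep: "{u, v} \<notin> edges (B b)" if "u \<in> F" "v \<in> F" for u v
    using F that by (simp add: indep_complex_def)
  have X_unique: "i = j" if "X i \<in> F" "X j \<in> F" for i j
    using indep[OF that] that sub by (auto simp: edge_B_iff)
  have Y_unique: "i = j" if "Y i \<in> F" "Y j \<in> F" for i j
    using indep[OF that] that sub by (auto simp: edge_B_iff)
  have X_Y: "i \<noteq> j" if "X i \<in> F" "Y j \<in> F" for i j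
    using indep[OF that] that sub by (auto simp: edge_B_iff)
  \<comment> \<open>The shape of \<open>F\<close> is determined by whether it meets the
    \<open>X\<close> side and the \<open>Y\<close> side. The four cases are the empty face, the two
    kinds of vertices, and the candidates for crown edges, where \<open>X_Y\<close> supplies
    \<open>i \<noteq> j\<close>.\<close>
  consider "F = {}" | i where "F = {X i}" | j where "F = {Y j}" | i j where "F = {X i, Y j}"
  proof (cases "\<exists>i. X i \<in> F"; cases "\<exists>j. Y j \<in> F")
    assume "\<exists>i. X i \<in> F" "\<exists>j. Y j \<in> F"
    then obtain i j where "X i \<in> F" "Y j \<in> F" by blast
    then have "F = {X i, Y j}" using sub X_unique Y_unique by blast
    then show thesis using that by blast
  next
    assume "\<exists>i. X i \<in> F" "\<nexists>j. Y j \<in> F"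
    then obtain i where "X i \<in> F" by blast
    then have "F = {X i}" using sub X_unique \<open>\<nexists>j. Y j \<in> F\<close> by blast
    then show thesis using that by blast
  next
    assume "\<nexists>i. X i \<in> F" "\<exists>j. Y j \<in> F"
    then obtain j where "Y j \<in> F" by blast
    then have "F = {Y j}" using sub Y_unique \<open>\<nexists>i. X i \<in> F\<close> by blast
    then show thesis using that by blast
  next
    assume "\<nexists>i. X i \<in> F" "\<nexists>j. Y j \<in> F"
    then have "F = {}" using sub by blast
    then show thesis using that by blast
  qed
  then show "F \<in> graph_complex (crown b)"
    using sub X_Y by cases (auto simp: graph_complex_def crown_def doubleton_eq_iff)
next
  fix F assume "F \<in> graph_complex (crown b)"
  then consider "F = {}" | i where "F = {X i}" "i \<in> {1..b}" | j where "F = {Y j}" "j \<in> {1..b}"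
    | i j where "F = {X i, Y j}" "i \<in> {1..b}" "j \<in> {1..b}" "i \<noteq> j"
    by (auto simp: graph_complex_def crown_def)
  then show "F \<in> indep_complex (B b)"
  proof cases
    case 4
    have "X i \<in> verts (B b)" "Y j \<in> verts (B b)"
      using 4 by (auto simp: B_def)
    \<comment> \<open>\<open>indep_complex\<close> also tests a vertex against itself and each pair
      in both orders, hence four non-edges.\<close>
    moreover have "{X i, X i} \<notin> edges (B b)" "{Y j, Y j} \<notin> edges (B b)"
      "{X i, Y j} \<notin> edges (B b)" "{Y j, X i} \<notin> edges (B b)"
      using 4 by (simp_all only: edge_B_iff, auto)
    ultimately show ?thesis
      unfolding indep_complex_def 4(1) by blast
  qed (auto simp: indep_complex_def B_def doubleton_eq_iff)
qed

lemma complex_edges_graph_complex: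
  assumes "simple_graph G"
  shows "complex_edges (graph_complex G) = edges G"
  using assms by (auto simp: complex_edges_def graph_complex_def simple_graph_def)

lemma card_face_graph_complex:
  assumes "simple_graph G" "F \<in> graph_complex G"
  shows "finite F" "card F \<le> 2"
  using assms by (auto simp: graph_complex_def simple_graph_def intro: finite_subset)

lemma finite_graph_complex:
  assumes "simple_graph G"
  shows "finite (graph_complex G)"
proof -
  have "edges G \<subseteq> Pow (verts G)" "finite (verts G)"
    using assms by (auto simp: simple_graph_def)
  then show ?thesis
    by (auto simp: graph_complex_def intro: finite_subset)
qed

text \<open>Without isolated vertices every singleton extends to an edge, and so does the empty face
  because some vertex exists. Edges are maximal since no face has more than two elements.\<close>

lemma facets_graph_complex:
  assumes G: "simple_graph G" and "verts G \<noteq> {}" "verts G \<subseteq> \<Union>(edges G)"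
  shows "facets (graph_complex G) = edges G"
proof (intro equalityI subsetI)
  fix F assume F: "F \<in> facets (graph_complex G)"
  then have "F = {} \<or> (\<exists>v\<in>verts G. F = {v}) \<or> F \<in> edges G"
    by (auto simp: facets_def graph_complex_def)
  then obtain e where e: "e \<in> edges G" "F \<subseteq> e"
    using assms(2,3) by blast
  then have "e = F"
    using F by (simp add: facets_def graph_complex_def)
  then show "F \<in> edges G"
    using e(1) by simp
next
  fix F assume F: "F \<in> edges G"
  then have "card F = 2" using G by (simp add: simple_graph_def)
  then have "F' = F" if "F' \<in> graph_complex G" "F \<subseteq> F'" for F'
    using card_face_graph_complex[OF G that(1)] that(2) by (metis card_seteq)
  then show "F \<in> facets (graph_complex G)"
    using F by (auto simp: facets_def graph_complex_def)
qed

lemma verts_crown_covered: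
  assumes "b \<ge> 2"
  shows "verts (crown b) \<subseteq> \<Union>(edges (crown b))"
proof -
  have "v \<in> \<Union>(edges (crown b))" if "v = X i \<or> v = Y i" and i: "i \<in> {1..b}" for v i
  proof -
    \<comment> \<open>Any index other than \<open>i\<close> serves as a partner;
      \<open>b \<ge> 2\<close> puts the choice in range.\<close>
    obtain j where "j \<in> {1..b}" "i \<noteq> j"
      using assms by (intro that[of "if i = 1 then 2 else 1"]) auto
    then have "{X i, Y j} \<in> edges (crown b)" "{X j, Y i} \<in> edges (crown b)"
      using i by (auto simp: crown_def)
    then show ?thesis
      using \<open>v = X i \<or> v = Y i\<close> by blast
  qed
  then show ?thesis
    by (auto simp: crown_def)
qed

text \<open>Edges correspond to ordered pairs of distinct indices: the constructors \<open>X\<close>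
  and \<open>Y\<close> tell the endpoints apart, so no edge is counted twice.\<close>

lemma card_edges_crown: "card (edges (crown b)) = b * (b - 1)"
proof -
  have "edges (crown b) = (\<lambda>(i, j). {X i, Y j}) ` (SIGMA i:{1..b}. {1..b} - {i})"
    by (auto simp: crown_def doubleton_eq_iff)
  moreover have "inj_on (\<lambda>(i, j). {X i, Y j}) (SIGMA i:{1..b}. {1..b} - {i})"
    by (auto simp: inj_on_def doubleton_eq_iff)
  ultimately show ?thesis
    by (simp add: card_image)
qed

section \<open>Decomposition, dimensions, facets and purity for the join graph\<close>

theorem proposition3p2:
  fixes a b n :: nat
  assumes "a \<ge> 1" and "n \<ge> 1" and "b \<ge> 3"
  shows "indep_complex (B b) \<cong>\<^sub>c graph_complex (crown b)
    \<and> indep_complex (Gabn a b n)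
        = simplex_on (verts (edgeless a)) \<union> join_power (indep_complex (B b)) n
    \<and> vertex_set (simplex_on (verts (edgeless a) :: xy label set))
        \<inter> vertex_set (join_power (indep_complex (B b)) n) = {}
    \<and> complex_dim (indep_complex (B b)) = 1
    \<and> complex_dim (join_power (indep_complex (B b)) n) = 2 * int n - 1
    \<and> facets (join_power (indep_complex (B b)) n)
        = {\<Union>k\<in>{1..n}. Block k ` e k | e. \<forall>k\<in>{1..n}. e k \<in> complex_edges (indep_complex (B b))}
    \<and> card (facets (join_power (indep_complex (B b)) n)) = (b * (b - 1)) ^ n
    \<and> (pure (indep_complex (Gabn a b n)) \<longleftrightarrow> a = 2 * n)"
proof -
  define \<Gamma> where "\<Gamma> = indep_complex (B b)"
  define J where "J = join_power \<Gamma> n"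
  define A :: "xy label set" where "A = verts (edgeless a)"
  have \<Gamma>: "\<Gamma> = graph_complex (crown b)"
    by (simp add: \<Gamma>_def indep_complex_B)
  have face: "finite F" "card F \<le> 2" if "F \<in> \<Gamma>" for F
    using card_face_graph_complex[OF simple_graph_crown] that by (auto simp: \<Gamma>)
  have finite_\<Gamma>: "finite \<Gamma>"
    by (simp add: \<Gamma> finite_graph_complex simple_graph_crown)
  have edges_\<Gamma>: "complex_edges \<Gamma> = edges (crown b)"
    by (simp add: \<Gamma> complex_edges_graph_complex simple_graph_crown)
  have facets_\<Gamma>: "facets \<Gamma> = complex_edges \<Gamma>"
    unfolding edges_\<Gamma> unfolding \<Gamma> using assms
    by (intro facets_graph_complex simple_graph_crown verts_crown_covered) (auto simp: crown_def)
  have "card (complex_edges \<Gamma>) > 0"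
    using assms by (simp add: edges_\<Gamma> card_edges_crown)
  \<comment> \<open>One fixed edge serves as a sample: it attains the dimension of
    \<open>\<Gamma>\<close>, and its copies build a facet of \<open>J\<close>.\<close>
  then obtain f where f: "f \<in> complex_edges \<Gamma>"
    by (metis card.empty equals0I less_irrefl)

  have facets_J: "facets J = {block_union n e | e. \<forall>k\<in>{1..n}. e k \<in> complex_edges \<Gamma>}"
    by (simp add: J_def facets_join_power facets_\<Gamma>)
  have card_facet: "card F = 2 * n" if F: "F \<in> facets J" for F
  proof -
    obtain e where e: "F = block_union n e" "\<forall>k\<in>{1..n}. e k \<in> complex_edges \<Gamma>"
      using F by (auto simp: facets_J)
    have "card F = (\<Sum>k=1..n. card (e k))"
      using e(2) unfolding e(1) complex_edges_def
      by (intro card_block_union face(1)) simp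
    also have "\<dots> = (\<Sum>k=1..n. 2)"
      using e(2) by (intro sum.cong) (auto simp: complex_edges_def)
    finally show ?thesis by simp
  qed
  have card_face: "card F \<le> 2 * n" if F: "F \<in> J" for F
  proof -
    obtain e where e: "F = block_union n e" "\<forall>k\<in>{1..n}. e k \<in> \<Gamma>"
      using F by (auto simp: J_def join_power_eq)
    have "card F = (\<Sum>k=1..n. card (e k))"
      using e(2) unfolding e(1) by (intro card_block_union face(1)) simp
    also have "\<dots> \<le> (\<Sum>k=1..n. 2)"
      using e(2) face(2) by (intro sum_mono) auto
    finally show ?thesis by simp
  qed
  \<comment> \<open>Placing \<open>f\<close> in every block gives a facet. It attains the dimension
    of \<open>J\<close>, shows that \<open>J\<close> has a nonempty face (as
    \<open>2 * n > 0\<close>), and is compared with \<open>A\<close> for purity.\<close>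
  have "block_union n (\<lambda>_. f) \<in> facets J"
    unfolding facets_J using f by blast
  then obtain F\<^sub>0 where F\<^sub>0: "F\<^sub>0 \<in> facets J"
    by blast
  then have F\<^sub>0_J: "F\<^sub>0 \<in> J" and F\<^sub>0_nonempty: "F\<^sub>0 \<noteq> {}"
    using card_facet[OF F\<^sub>0] assms by (auto simp: facets_def)

  have iso: "\<Gamma> \<cong>\<^sub>c graph_complex (crown b)"
    unfolding \<Gamma> complex_iso_def by (intro exI[of _ id]) simp
  have decomposition: "indep_complex (Gabn a b n) = simplex_on A \<union> J"
    unfolding Gabn_def A_def J_def \<Gamma>_def
    by (simp add: indep_complex_join simple_graph_edgeless simple_graph_copies simple_graph_B
        edgeless_copies_disjoint indep_complex_edgeless indep_complex_copies)
  \<comment> \<open>Stated for unions of faces, the form used by \<open>facets_Un_disjoint\<close>;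
    a vertex \<open>v\<close> enters the union through the face \<open>{v}\<close>, so disjointness
    of the vertex sets follows.\<close>
  have disjoint: "\<Union>(simplex_on A) \<inter> \<Union>J = {}"
    by (auto simp: simplex_on_def A_def edgeless_def J_def join_power_eq block_union_def)
  then have disjoint_vertices: "vertex_set (simplex_on A) \<inter> vertex_set J = {}"
    by (auto simp: vertex_set_def)
  have dim_\<Gamma>: "complex_dim \<Gamma> = 1"
    using complex_dim_eqI[OF finite_\<Gamma>, of 2 f] face(2) f by (auto simp: complex_edges_def)
  have dim_J: "complex_dim J = 2 * int n - 1"
    using complex_dim_eqI[OF _ card_face F\<^sub>0_J card_facet[OF F\<^sub>0]]
    by (simp add: J_def finite_join_power finite_\<Gamma>)
  have card_facets_J: "card (facets J) = (b * (b - 1)) ^ n"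
    by (simp add: J_def card_facets_join_power facets_\<Gamma> edges_\<Gamma> card_edges_crown)

  have "facets (simplex_on A) = {A}"
    by (auto simp: facets_def simplex_on_def)
  moreover have "\<Union>(simplex_on A) \<noteq> {}"
    using assms by (auto simp: simplex_on_def A_def edgeless_def)
  moreover have "\<Union>J \<noteq> {}"
    using F\<^sub>0_J F\<^sub>0_nonempty by blast
  ultimately have "facets (simplex_on A \<union> J) = {A} \<union> facets J"
    using facets_Un_disjoint[OF disjoint] by simp
  moreover have "card A = a"
    by (simp add: A_def edgeless_def card_image inj_on_def)
  \<comment> \<open>Both \<open>A\<close>, of size \<open>a\<close>, and \<open>F\<^sub>0\<close>,
    of size \<open>2 * n\<close>, are facets, so purity forces equality; conversely these are the
    only facet sizes.\<close>
  ultimately have "pure (simplex_on A \<union> J) \<longleftrightarrow> a = 2 * n"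
    using F\<^sub>0 card_facet by (auto simp: pure_def)
  then show ?thesis
    using iso decomposition disjoint_vertices dim_\<Gamma> dim_J facets_J card_facets_J
    unfolding \<Gamma>_def J_def A_def block_union_def by simp
qed

end
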